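(* Let $k,m\in\mathbb N_0$ with $0\leq k\leq m$, and let $a$ be a number. Then $$\sum_{\substack{i=0\\ m+i~\text{even}}}^{m}\binom mi\binom{m+i}{k}E_{m+i-k}(a)=\sum_{j=0}^m(-1)^{m+j}\binom mj\binom{m+j}{k}a^{m+j-k},$$ where the left-hand sum runs over those $i\in\{0,\dots,m\}$ with $m+i$ even.
   Context: The Euler polynomials $E_n(a)$ are defined by $\frac{2e^{at}}{e^t+1}=\sum_{n=0}^\infty E_n(a)\frac{t^n}{n!}$; $\binom{N}{k}$ denotes the binomial coefficient. *)

theory Defs
  imports Complex_Main "HOL-Computational_Algebra.Formal_Power_Series"
begin

text \<open>The value at \<open>a\<close> of the \<open>n\<close>-th Euler polynomial, read off from the exponential generating
  function \<open>2 e\<^sup>a\<^sup>t / (e\<^sup>t + 1) = (\<Sum>n. E\<^sub>n(a) t\<^sup>n / n!)\<close>. Here \<open>fps_exp a\<close> is the power series of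
  \<open>e\<^sup>a\<^sup>t\<close> in \<open>t\<close>; the denominator has constant term 2, so the division is by a unit.\<close>

definition euler_poly :: "nat \<Rightarrow> 'a :: field_char_0 \<Rightarrow> 'a" where
  "euler_poly n a = fact n * fps_nth (2 * fps_exp a / (fps_exp 1 + 1)) n"

end

theory Submission
  imports Defs "HOL-Computational_Algebra.Polynomial"
begin

text \<open>Let \<open>L\<close> be the linear functional on polynomials with \<open>L (x\<^sup>n) = E\<^sub>n(a)\<close>. The generating function
  gives \<open>L (p(x + 1) + p(x)) = 2 p(a)\<close> for every polynomial \<open>p\<close>. For \<open>q = x\<^sup>m (x - 1)\<^sup>m\<close> the terms with
  \<open>m + i\<close> odd cancel in \<open>q(x + 1) + q(x) = x\<^sup>m ((x + 1)\<^sup>m + (x - 1)\<^sup>m)\<close>, which leaves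
  twice the sum of \<open>(m choose i) x\<^sup>m\<^sup>+\<^sup>i\<close> over the \<open>i\<close> with \<open>m + i\<close> even. Since
  differentiation commutes with shifts, the theorem is \<open>L (p(x + 1) + p(x)) = 2 p(a)\<close> for \<open>p\<close> the
  \<open>k\<close>-th derivative of \<open>q\<close>, divided by \<open>2 k!\<close>.\<close>

text \<open>Multiply the generating function by \<open>e^t + 1\<close> and compare coefficients of
  \<open>t^n\<close>, scaled by \<open>n!\<close>. This is the case \<open>p = x^n\<close> of the
  identity for \<open>L\<close>.\<close>

lemma sum_choose_euler_poly:
  fixes a :: "'a :: field_char_0"
  shows "(\<Sum>j\<le>n. of_nat (n choose j) * euler_poly j a) + euler_poly n a = 2 * a ^ n"
proof -
  define G :: "'a fps" where "G = 2 * fps_exp a / (fps_exp 1 + 1)"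
  have E: "euler_poly j a = fact j * fps_nth G j" for j
    by (simp add: euler_poly_def G_def)
  have "(fps_exp 1 + 1 :: 'a fps) dvd 2 * fps_exp a"
    by (rule dvd_trans[of _ 1]) (simp_all add: fps_is_unit_iff)
  then have "G * (fps_exp 1 + 1) = 2 * fps_exp a"
    unfolding G_def by (rule dvd_div_mult_self)
  then have "fps_nth (G * fps_exp 1 + G) n = fps_nth (fps_const 2 * fps_exp a) n"
    by (simp add: algebra_simps numeral_fps_const)
  then have "(\<Sum>j\<le>n. fps_nth G j / fact (n - j)) + fps_nth G n = 2 * a ^ n / fact n"
    unfolding fps_add_nth fps_mult_left_const_nth
    by (simp add: fps_mult_nth atLeast0AtMost)
  then have "fact n * ((\<Sum>j\<le>n. fps_nth G j / fact (n - j)) + fps_nth G n) = 2 * a ^ n"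
    by simp
  moreover have "of_nat (n choose j) * euler_poly j a = fact n * (fps_nth G j / fact (n - j))"
    if "j \<le> n" for j
    using that by (simp add: E binomial_fact field_simps)
  ultimately show ?thesis
    by (simp add: E distrib_left sum_distrib_left)
qed

text \<open>This is the functional \<open>L\<close>.\<close>

definition euler_functional :: "'a :: field_char_0 \<Rightarrow> 'a poly \<Rightarrow> 'a" where
  "euler_functional a p = (\<Sum>i\<le>degree p. coeff p i * euler_poly i a)"

text \<open>Coefficients beyond the degree vanish. A free upper bound lets polynomials of different
  degrees share one summation range, as additivity requires.\<close>

lemma euler_functional_altdef:
  assumes "degree p \<le> n"
  shows "euler_functional a p = (\<Sum>i\<le>n. coeff p i * euler_poly i a)"
  unfolding euler_functional_def
  by (rule sum.mono_neutral_left) (use assms in \<open>auto simp: coeff_eq_0\<close>)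

lemma euler_functional_add:
  "euler_functional a (p + q) = euler_functional a p + euler_functional a q"
proof -
  let ?n = "max (degree p) (degree q)"
  have "degree (p + q) \<le> ?n"
    by (rule degree_add_le_max)
  then show ?thesis
    by (simp add: euler_functional_altdef[of _ ?n] sum.distrib algebra_simps)
qed

lemma euler_functional_smult: "euler_functional a (smult c p) = c * euler_functional a p"
  by (simp add: euler_functional_altdef[of _ "degree p"] degree_smult_le sum_distrib_left mult.assoc)

lemma euler_functional_0 [simp]: "euler_functional a 0 = 0"
  by (simp add: euler_functional_def)

lemma euler_functional_sum:
  "euler_functional a (\<Sum>i\<in>A. f i) = (\<Sum>i\<in>A. euler_functional a (f i))"
  by (induction A rule: infinite_finite_induct) (simp_all add: euler_functional_add)

lemma euler_functional_monom: "euler_functional a (monom c n) = c * euler_poly n a"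
  by (subst euler_functional_altdef[of _ n])
     (simp_all add: degree_monom_le if_distrib[of "\<lambda>x. x * _"] sum.delta cong: if_cong)

lemma linear_power_eq_sum_monom:
  fixes c :: "'a :: comm_ring_1"
  shows "[:c, 1:] ^ n = (\<Sum>i\<le>n. monom (of_nat (n choose i) * c ^ (n - i)) i)"
proof -
  have "[:c, 1:] ^ n = (monom 1 1 + [:c:]) ^ n"
    by (simp add: monom_altdef)
  also have "\<dots> = (\<Sum>i\<le>n. monom (of_nat (n choose i) * c ^ (n - i)) i)"
    unfolding binomial_ring
    by (intro sum.cong)
       (simp_all add: monom_power of_nat_poly poly_const_pow smult_monom mult_ac)
  finally show ?thesis .
qed

lemma pcompose_power: "pcompose (p ^ n) q = pcompose p q ^ n"
  for p q :: "'a :: comm_ring_1 poly"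
  by (induction n) (simp_all add: pcompose_mult pcompose_1)

text \<open>By linearity it suffices to treat monomials; there the binomial expansion of
  \<open>(x + 1)^n\<close> reduces the claim to \<open>sum_choose_euler_poly\<close>.\<close>

lemma euler_functional_shift:
  "euler_functional a (pcompose p [:1, 1:] + p) = 2 * poly p a"
proof -
  have mono: "euler_functional a (pcompose (monom c n) [:1, 1:] + monom c n) = 2 * poly (monom c n) a"
    for c n
  proof -
    have "pcompose (monom c n) [:1, 1:] = smult c ([:1, 1:] ^ n)"
      by (simp add: monom_altdef pcompose_smult pcompose_power pcompose_pCons)
    then have "euler_functional a (pcompose (monom c n) [:1, 1:] + monom c n)
        = c * ((\<Sum>i\<le>n. of_nat (n choose i) * euler_poly i a) + euler_poly n a)"
      by (simp add: linear_power_eq_sum_monom euler_functional_add euler_functional_smult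
          euler_functional_sum euler_functional_monom distrib_left)
    then show ?thesis
      by (simp add: sum_choose_euler_poly poly_monom)
  qed
  have "euler_functional a (pcompose p [:1, 1:] + p)
      = euler_functional a (\<Sum>i\<le>degree p. pcompose (monom (coeff p i) i) [:1, 1:] + monom (coeff p i) i)"
    by (subst (1 2) poly_as_sum_of_monoms[of p, symmetric]) (simp only: pcompose_sum sum.distrib)
  also have "\<dots> = 2 * poly (\<Sum>i\<le>degree p. monom (coeff p i) i) a"
    by (simp only: euler_functional_sum mono poly_sum sum_distrib_left)
  finally show ?thesis
    by (simp only: poly_as_sum_of_monoms)
qed

lemma higher_pderiv_pcompose_shift:
  fixes p :: "'a :: field_char_0 poly"
  shows "(pderiv ^^ k) (pcompose p [:c, 1:]) = pcompose ((pderiv ^^ k) p) [:c, 1:]"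
  by (induction k) (simp_all add: pderiv_pcompose pderiv_pCons)

lemma higher_pderiv_monom_choose:
  fixes c :: "'a :: field_char_0"
  assumes "k \<le> n"
  shows "(pderiv ^^ k) (monom c n) = monom (fact k * (of_nat (n choose k) * c)) (n - k)"
proof (rule poly_eqI)
  fix i
  \<comment> \<open>The library writes the factor produced by \<open>k\<close> derivatives as the
    rising factorial from \<open>n - k + 1\<close> to \<open>n\<close>.\<close>
  have "pochhammer (of_nat (Suc (n - k))) k = (fact k * of_nat (n choose k) :: 'a)"
    using assms by (simp add: binomial_gbinomial gbinomial_pochhammer' of_nat_diff add.commute)
  then show "coeff ((pderiv ^^ k) (monom c n)) i
      = coeff (monom (fact k * (of_nat (n choose k) * c)) (n - k)) i"
    using assms by (auto simp: coeff_higher_pderiv mult.assoc simp del: of_nat_Suc)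
qed

theorem theorem1p12:
  fixes k m :: nat and a :: complex
  assumes "k \<le> m"
  shows "(\<Sum>i | i \<le> m \<and> even (m + i).
            of_nat (m choose i) * of_nat ((m + i) choose k) * euler_poly (m + i - k) a)
       = (\<Sum>j=0..m. (-1) ^ (m + j) * of_nat (m choose j) * of_nat ((m + j) choose k)
            * a ^ (m + j - k))"
    (is "?L = ?R")
proof -
  define q :: "complex poly" where "q = monom 1 m * [:-1, 1:] ^ m"
  define r where "r = (pderiv ^^ k) q"
  \<comment> \<open>The binomial theorem gives the sign \<open>(-1)^(m - i)\<close>; the exponent
    \<open>m + i\<close> has the same parity and matches the right-hand side.\<close>
  have q: "q = (\<Sum>i\<le>m. monom (of_nat (m choose i) * (-1) ^ (m + i)) (m + i))"
    unfolding q_def linear_power_eq_sum_monom sum_distrib_left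
    by (intro sum.cong) (auto simp: mult_monom minus_one_power_iff)
  \<comment> \<open>The shift turns \<open>x^m\<close> into \<open>(x + 1)^m\<close> and
    \<open>(x - 1)^m\<close> into \<open>x^m\<close>, so both summands expand in the same powers
    \<open>x^(m + i)\<close>.\<close>
  have "pcompose q [:1, 1:] = [:1, 1:] ^ m * monom 1 m"
    by (simp add: q_def monom_altdef pcompose_mult pcompose_smult pcompose_power pcompose_pCons)
  then have q_shift: "pcompose q [:1, 1:] = (\<Sum>i\<le>m. monom (of_nat (m choose i)) (m + i))"
    by (simp add: linear_power_eq_sum_monom sum_distrib_right mult_monom add.commute)
  have "pcompose q [:1, 1:] + q
      = (\<Sum>i\<le>m. if even (m + i) then monom (2 * of_nat (m choose i)) (m + i) else 0)"
    unfolding q_shift unfolding q sum.distrib[symmetric]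
    by (rule sum.cong) (simp_all add: add_monom)
  also have "\<dots> = (\<Sum>i | i \<le> m \<and> even (m + i). monom (2 * of_nat (m choose i)) (m + i))"
    by (subst sum.inter_filter[symmetric]) simp_all
  \<comment> \<open>From \<open>k \<le> m\<close> follows \<open>k \<le> m + i\<close>, so the
    derivative formula applies to every monomial.\<close>
  finally have "euler_functional a ((pderiv ^^ k) (pcompose q [:1, 1:] + q)) = 2 * fact k * ?L"
    using assms
    by (simp add: higher_pderiv_sum higher_pderiv_monom_choose euler_functional_sum
        euler_functional_monom sum_distrib_left mult_ac)
  moreover have "(pderiv ^^ k) (pcompose q [:1, 1:] + q) = pcompose r [:1, 1:] + r"
    by (simp add: r_def higher_pderiv_pcompose_shift higher_pderiv_add)
  ultimately have "2 * fact k * ?L = 2 * poly r a"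
    by (simp only: euler_functional_shift)
  \<comment> \<open>Here the signed expansion of \<open>q\<close> is differentiated termwise and
    evaluated at \<open>a\<close>.\<close>
  also have "poly r a = fact k * ?R"
    using assms
    by (simp add: r_def q higher_pderiv_sum higher_pderiv_monom_choose poly_sum poly_monom
        sum_distrib_left mult_ac atLeast0AtMost)
  finally show ?thesis
    by simp
qed

end
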